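(* For every fixed integer $k\geq 1$ there exists a polynomial-time online algorithm that, given as input any finite sequence of intervals $S=(I_1,I_2,\ldots,I_n)$, computes a partition of $S$ into a minimum number of $k$-ary chains, in such a way that each interval $I_i$, at the time it is considered, is either inserted as a leaf into one of the existing $k$-ary chains or starts a new $k$-ary chain.
   Context: Intervals are closed real intervals $[a,b]$ with $a<b$. The (strict) partial order on intervals is: $[a_1,b_1]$ is below $[a_2,b_2]$ if and only if $b_1\leq a_2$. A rooted tree is $k$-ary if every node has at most $k$ children. A $k$-ary chain of a poset is a subset $A$ of its elements for which there exist a $k$-ary rooted tree $T$ and a bijection between $A$ and the vertices of $T$ such that whenever $v$ is a (proper) descendant of $u$ in $T$, $u<v$ in the poset. A sequence of intervals $S=(I_1,\ldots,I_n)$ is identified with the poset on $\{(i,I_i):1\leq i\leq n\}$ in which $(i,I_i)<(j,I_j)$ if and only if $i<j$ and $I_i$ is below $I_j$. A partition of $S$ into $k$-ary chains means a partition of this poset into $k$-ary chains; "minimum" is with respect to the number of classes, over all partitions of this poset into $k$-ary chains. Online means: the algorithm considers $I_1,I_2,\ldots,I_n$ in this order and maintains a forest of $k$-ary rooted trees (each witnessing that its vertex set is a $k$-ary chain) on the intervals considered so far. When $I_i$ is considered, the algorithm, without knowledge of $I_{i+1},\ldots,I_n$ and irrevocably, either makes $I_i$ a new leaf, as a child of an already placed node $I_j$ which is below $I_i$ and has fewer than $k$ children, or makes $I_i$ the root of a new tree. The output partition consists of the vertex sets of the trees of the final forest. *)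

theory Defs
  imports Complex_Main "HOL-Library.Disjoint_Sets" "HOL-Computational_Algebra.Polynomial"
begin

section \<open>Chains of bounded arity in a partially ordered set\<close>

text \<open>
  A rooted tree is given by its vertex set, its set of (parent, child) pairs and its root;
  \<open>(u, v) \<in> E\<^sup>+\<close> says that \<open>v\<close> is a proper descendant of \<open>u\<close>.
\<close>

definition rooted_tree :: "'v set \<Rightarrow> ('v \<times> 'v) set \<Rightarrow> 'v \<Rightarrow> bool" where
  "rooted_tree V E r \<longleftrightarrow>
     r \<in> V \<and> E \<subseteq> V \<times> V \<and>
     (\<forall>v\<in>V. (r, v) \<in> E\<^sup>*) \<and>
     (\<forall>u. (u, r) \<notin> E) \<and>
     (\<forall>v\<in>V - {r}. \<exists>!u. (u, v) \<in> E)"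

definition kary_rooted_tree :: "nat \<Rightarrow> 'v set \<Rightarrow> ('v \<times> 'v) set \<Rightarrow> 'v \<Rightarrow> bool" where
  "kary_rooted_tree k V E r \<longleftrightarrow>
     rooted_tree V E r \<and> (\<forall>u\<in>V. finite (E `` {u}) \<and> card (E `` {u}) \<le> k)"

text \<open>
  The vertices of the tree are taken from the type of the poset elements. This is no
  restriction, because the vertex set has to be in bijection with \<open>A\<close>.
\<close>

definition kary_chain :: "nat \<Rightarrow> 'a set \<Rightarrow> ('a \<Rightarrow> 'a \<Rightarrow> bool) \<Rightarrow> 'a set \<Rightarrow> bool" where
  "kary_chain k X lt A \<longleftrightarrow>
     A \<subseteq> X \<and>
     (\<exists>(V :: 'a set) E r \<phi>. kary_rooted_tree k V E r \<and> bij_betw \<phi> V A \<and>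
        (\<forall>u v. (u, v) \<in> E\<^sup>+ \<longrightarrow> lt (\<phi> u) (\<phi> v)))"

definition kary_partition :: "nat \<Rightarrow> 'a set \<Rightarrow> ('a \<Rightarrow> 'a \<Rightarrow> bool) \<Rightarrow> 'a set set \<Rightarrow> bool" where
  "kary_partition k X lt P \<longleftrightarrow> partition_on X P \<and> (\<forall>A\<in>P. kary_chain k X lt A)"

definition minimum_kary_partition ::
    "nat \<Rightarrow> 'a set \<Rightarrow> ('a \<Rightarrow> 'a \<Rightarrow> bool) \<Rightarrow> 'a set set \<Rightarrow> bool" where
  "minimum_kary_partition k X lt P \<longleftrightarrow>
     kary_partition k X lt P \<and> (\<forall>Q. kary_partition k X lt Q \<longrightarrow> card P \<le> card Q)"

section \<open>Sequences of intervals\<close>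

text \<open>The pair \<open>(a, b)\<close> stands for the closed interval from \<open>a\<close> to \<open>b\<close>.\<close>

type_synonym ival = "real \<times> real"

definition proper_ival :: "ival \<Rightarrow> bool" where
  "proper_ival I \<longleftrightarrow> fst I < snd I"

definition ival_below :: "ival \<Rightarrow> ival \<Rightarrow> bool" where
  "ival_below I J \<longleftrightarrow> snd I \<le> fst J"

text \<open>Positions in a sequence are counted from 0.\<close>

definition seq_elems :: "ival list \<Rightarrow> (nat \<times> ival) set" where
  "seq_elems S = {(i, S ! i) | i. i < length S}"

definition seq_less :: "nat \<times> ival \<Rightarrow> nat \<times> ival \<Rightarrow> bool" where
  "seq_less x y \<longleftrightarrow> fst x < fst y \<and> ival_below (snd x) (snd y)"

section \<open>Online insertion into a forest\<close>

text \<open>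
  A list \<open>D\<close> of decisions describes how a forest is built: \<open>D ! i = None\<close> if the interval at
  position \<open>i\<close> becomes the root of a new tree, and \<open>D ! i = Some j\<close> if it becomes a new leaf,
  as a child of the interval at position \<open>j\<close>.
\<close>

definition legal_insertions :: "nat \<Rightarrow> ival list \<Rightarrow> nat option list \<Rightarrow> bool" where
  "legal_insertions k S D \<longleftrightarrow>
     length D = length S \<and>
     (\<forall>i<length S. \<forall>j. D ! i = Some j \<longrightarrow>
        j < i \<and> ival_below (S ! j) (S ! i) \<and> card {m. m < i \<and> D ! m = Some j} < k)"

definition forest_edges ::
    "ival list \<Rightarrow> nat option list \<Rightarrow> ((nat \<times> ival) \<times> (nat \<times> ival)) set" where
  "forest_edges S D = {((j, S ! j), (i, S ! i)) | i j. i < length S \<and> D ! i = Some j}"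

definition forest_classes :: "ival list \<Rightarrow> nat option list \<Rightarrow> (nat \<times> ival) set set" where
  "forest_classes S D =
     {(forest_edges S D)\<^sup>* `` {(i, S ! i)} | i. i < length S \<and> D ! i = None}"

section \<open>The machine model\<close>

text \<open>
  Programs run on a random access machine with finitely many (as many as the program mentions)
  unbounded arrays of natural numbers and unbounded arrays of real numbers. Real numbers can be
  copied and compared, but there is no arithmetic on them. Hence a time bound in this model is also
  one for the real RAM, and, as natural numbers are only added and subtracted, a polynomial bound
  gives polynomial time on Turing machines when endpoints are rational.
\<close>

record memory =
  nats :: "nat \<Rightarrow> nat \<Rightarrow> nat"
  reals :: "nat \<Rightarrow> nat \<Rightarrow> real"

datatype nexp = Const nat | NCell nat nexp | Plus nexp nexp | Minus nexp nexp

datatype rexp = RCell nat nexp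

datatype test = NLess nexp nexp | RLess rexp rexp | Neg test | Conj test test

datatype prog =
    Skip
  | NStore nat nexp nexp
  | RStore nat nexp rexp
  | Seq prog prog
  | Cond test prog prog
  | While test prog

primrec nval :: "nexp \<Rightarrow> memory \<Rightarrow> nat" where
  "nval (Const n) s = n"
| "nval (NCell x e) s = nats s x (nval e s)"
| "nval (Plus e f) s = nval e s + nval f s"
| "nval (Minus e f) s = nval e s - nval f s"

primrec rval :: "rexp \<Rightarrow> memory \<Rightarrow> real" where
  "rval (RCell x e) s = reals s x (nval e s)"

primrec tval :: "test \<Rightarrow> memory \<Rightarrow> bool" where
  "tval (NLess e f) s \<longleftrightarrow> nval e s < nval f s"
| "tval (RLess e f) s \<longleftrightarrow> rval e s < rval f s"
| "tval (Neg t) s \<longleftrightarrow> \<not> tval t s"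
| "tval (Conj t u) s \<longleftrightarrow> tval t s \<and> tval u s"

text \<open>
  \<open>exec P s t s'\<close>: started in \<open>s\<close>, the program \<open>P\<close> halts in \<open>s'\<close> after \<open>t\<close> steps. Every elementary
  command and every evaluation of a test is one step; the sizes of the expressions occurring in a
  program contribute only a constant factor that depends on the program alone.
\<close>

inductive exec :: "prog \<Rightarrow> memory \<Rightarrow> nat \<Rightarrow> memory \<Rightarrow> bool" where
  Skip: "exec Skip s 1 s"
| NStore: "exec (NStore x e f) s 1
     (s\<lparr>nats := (nats s)(x := (nats s x)(nval e s := nval f s))\<rparr>)"
| RStore: "exec (RStore x e f) s 1
     (s\<lparr>reals := (reals s)(x := (reals s x)(nval e s := rval f s))\<rparr>)"
| Seq: "exec P s t s' \<Longrightarrow> exec Q s' u s'' \<Longrightarrow> exec (Seq P Q) s (t + u) s''"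
| CondTrue: "tval b s \<Longrightarrow> exec P s t s' \<Longrightarrow> exec (Cond b P Q) s (Suc t) s'"
| CondFalse: "\<not> tval b s \<Longrightarrow> exec Q s t s' \<Longrightarrow> exec (Cond b P Q) s (Suc t) s'"
| WhileFalse: "\<not> tval b s \<Longrightarrow> exec (While b P) s 1 s"
| WhileTrue: "tval b s \<Longrightarrow> exec P s t s' \<Longrightarrow> exec (While b P) s' u s'' \<Longrightarrow>
     exec (While b P) s (Suc (t + u)) s''"

lemma exec_deterministic:
  "exec P s t s' \<Longrightarrow> exec P s u s'' \<Longrightarrow> u = t \<and> s'' = s'"
proof (induction arbitrary: u s'' rule: exec.induct)
  case Skip
  then show ?case by (auto elim: exec.cases)
next
  case NStore
  then show ?case by (auto elim: exec.cases)
next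
  case RStore
  then show ?case by (auto elim: exec.cases)
next
  case Seq
  from Seq.prems show ?case by cases (use Seq.IH in blast)
next
  case CondTrue
  from CondTrue.prems show ?case by cases (use CondTrue in blast)+
next
  case CondFalse
  from CondFalse.prems show ?case by cases (use CondFalse in blast)+
next
  case WhileFalse
  from WhileFalse.prems show ?case by cases (use WhileFalse in auto)
next
  case WhileTrue
  from WhileTrue.prems show ?case by cases (use WhileTrue in blast)+
qed

section \<open>Online algorithms\<close>

text \<open>
  An online algorithm is a program that is run once for each interval. The endpoints of the
  current interval are put into cells 0 and 1 of the array 0 of reals; everything else in memory
  is as the previous run left it (and 0 at the very beginning). When the run halts, cell 0 of the
  array 0 of naturals holds the decision: 0 stands for a new root, and \<open>Suc j\<close> for a new child of
  the interval at position \<open>j\<close>. So a decision can depend only on the intervals seen so far, and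
  it is never revised.
\<close>

definition start_memory :: memory where
  "start_memory = \<lparr>nats = (\<lambda>_ _. 0), reals = (\<lambda>_ _. 0)\<rparr>"

definition load_ival :: "ival \<Rightarrow> memory \<Rightarrow> memory" where
  "load_ival I s = s\<lparr>reals := (reals s)(0 := (reals s 0)(0 := fst I, 1 := snd I))\<rparr>"

definition decision :: "memory \<Rightarrow> nat option" where
  "decision s = (case nats s 0 0 of 0 \<Rightarrow> None | Suc j \<Rightarrow> Some j)"

inductive online_run ::
    "prog \<Rightarrow> memory \<Rightarrow> ival list \<Rightarrow> nat option list \<Rightarrow> nat \<Rightarrow> bool" for P where
  Nil: "online_run P s [] [] 0"
| Cons: "exec P (load_ival I s) t s' \<Longrightarrow> online_run P s' S D u \<Longrightarrow>
     online_run P s (I # S) (decision s' # D) (t + u)"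

lemma online_run_deterministic:
  "online_run P s S D t \<Longrightarrow> online_run P s S D' t' \<Longrightarrow> D' = D \<and> t' = t"
proof (induction arbitrary: D' t' rule: online_run.induct)
  case Nil
  then show ?case by (auto elim: online_run.cases)
next
  case Cons
  from Cons.prems show ?case by cases (use Cons exec_deterministic in blast)
qed

end

theory Submission
  imports Defs
begin

text \<open>
  The algorithm is best fit: an arriving interval \<open>[a, b]\<close> becomes a child of a node whose right
  endpoint is largest among the nodes with right endpoint at most \<open>a\<close> and fewer than \<open>k\<close>
  children, and it becomes a root only if there is no such node. Compare this with an arbitrary
  partition into \<open>k\<close>-ary chains, read as another parent function. At every time and for every
  threshold \<open>x\<close>, best fit has attached at least as many intervals to parents with right endpoint
  beyond \<open>x\<close> as the other partition has: if only the other one attaches the new interval beyond \<open>x\<close>,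
  then best fit has no free place left in \<open>(x, a]\<close>, so it is ahead there, and it is not behind
  beyond \<open>a\<close> by the invariant for the threshold \<open>a\<close>. For small \<open>x\<close> this says that best fit has
  at least as many non-roots, hence at most as many trees.
\<close>

section \<open>Best fit\<close>

definition free_place ::
    "nat \<Rightarrow> (nat \<Rightarrow> ival) \<Rightarrow> (nat \<Rightarrow> nat option) \<Rightarrow> nat \<Rightarrow> nat \<Rightarrow> bool" where
  "free_place k I D i j \<longleftrightarrow>
     j < i \<and> ival_below (I j) (I i) \<and> card {m. m < i \<and> D m = Some j} < k"

text \<open>A relation rather than a function: ties between equal right endpoints stay open, so the
  optimality argument does not depend on how the program breaks them.\<close>

definition best_fit :: "nat \<Rightarrow> (nat \<Rightarrow> ival) \<Rightarrow> (nat \<Rightarrow> nat option) \<Rightarrow> nat \<Rightarrow> bool" where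
  "best_fit k I D i \<longleftrightarrow> (case D i of
       None \<Rightarrow> \<forall>j. \<not> free_place k I D i j
     | Some j \<Rightarrow> free_place k I D i j \<and> (\<forall>j'. free_place k I D i j' \<longrightarrow> snd (I j') \<le> snd (I j)))"

definition attached_beyond :: "(nat \<Rightarrow> ival) \<Rightarrow> (nat \<Rightarrow> nat option) \<Rightarrow> nat \<Rightarrow> real \<Rightarrow> nat set" where
  "attached_beyond I D i x = {m. m < i \<and> (\<exists>j. D m = Some j \<and> x < snd (I j))}"

lemma finite_attached_beyond [simp]: "finite (attached_beyond I D i x)"
  by (simp add: attached_beyond_def)

lemma attached_beyond_Suc:
  "attached_beyond I D (Suc i) x =
     (if \<exists>j. D i = Some j \<and> x < snd (I j) then insert i else id) (attached_beyond I D i x)"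
  by (auto simp: attached_beyond_def less_Suc_eq)

lemma card_attached_beyond_Suc:
  "card (attached_beyond I D (Suc i) x) =
     card (attached_beyond I D i x) + (if \<exists>j. D i = Some j \<and> x < snd (I j) then 1 else 0)"
proof -
  have "i \<notin> attached_beyond I D i x"
    by (simp add: attached_beyond_def)
  then show ?thesis
    by (simp add: attached_beyond_Suc)
qed

text \<open>Sort the attached intervals by parent; those with parent endpoint in
  \<open>(x, y]\<close> are counted parent by parent. The bound \<open>i\<close> on parents is kept
  apart from the time \<open>N\<close>, so that two forests at times \<open>Suc i\<close> and
  \<open>i\<close> can be summed over the same index set.\<close>

lemma card_attached_beyond_split:
  assumes "x \<le> y" and parent_less: "\<And>m j. m < N \<Longrightarrow> D m = Some j \<Longrightarrow> j < i"
  shows "card (attached_beyond I D N x) =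
     (\<Sum>j | j < i \<and> x < snd (I j) \<and> snd (I j) \<le> y. card {m. m < N \<and> D m = Some j})
     + card (attached_beyond I D N y)"
proof -
  let ?J = "{j. j < i \<and> x < snd (I j) \<and> snd (I j) \<le> y}"
  let ?C = "\<lambda>j. {m. m < N \<and> D m = Some j}"
  have "attached_beyond I D N x = (\<Union>j\<in>?J. ?C j) \<union> attached_beyond I D N y"
    using assms by (force simp: attached_beyond_def)
  moreover have "(\<Union>j\<in>?J. ?C j) \<inter> attached_beyond I D N y = {}"
    by (auto simp: attached_beyond_def)
  ultimately have "card (attached_beyond I D N x) =
      card (\<Union>j\<in>?J. ?C j) + card (attached_beyond I D N y)"
    by (simp add: card_Un_disjoint)
  also have "card (\<Union>j\<in>?J. ?C j) = (\<Sum>j\<in>?J. card (?C j))"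
    by (rule card_UN_disjoint) auto
  finally show ?thesis .
qed

text \<open>The induction keeps \<open>x\<close> arbitrary because the critical case uses the
  hypothesis at the threshold \<open>fst (I i)\<close> instead of \<open>x\<close>.\<close>

lemma best_fit_dominates:
  assumes best: "\<And>i. i < n \<Longrightarrow> best_fit k I D i"
    and below: "\<And>m j. m < n \<Longrightarrow> D' m = Some j \<Longrightarrow> j < m \<and> ival_below (I j) (I m)"
    and arity: "\<And>j. card {m. m < n \<and> D' m = Some j} \<le> k"
    and "i \<le> n"
  shows "card (attached_beyond I D' i x) \<le> card (attached_beyond I D i x)"
  using \<open>i \<le> n\<close>
proof (induction i arbitrary: x)
  case 0
  then show ?case
    by (simp add: attached_beyond_def)
next
  case (Suc i)
  then have "i < n"
    by simp
  have IH: "card (attached_beyond I D' i y) \<le> card (attached_beyond I D i y)" for y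
    using Suc by simp
  have D_less: "j < i" if "m < i" "D m = Some j" for m j
    using best[of m] that \<open>i < n\<close> by (auto simp: best_fit_def free_place_def)
  let ?a = "fst (I i)"
  show ?case
  proof (cases "(\<exists>j. D' i = Some j \<and> x < snd (I j)) \<and> \<not> (\<exists>j. D i = Some j \<and> x < snd (I j))")
    case False
    then show ?thesis
      using IH[of x] by (auto simp: card_attached_beyond_Suc)
  next
    case True
    then obtain j' where j': "D' i = Some j'" "x < snd (I j')"
      by blast
    have j'_le: "snd (I j') \<le> ?a"
      using below[OF \<open>i < n\<close> j'(1)] by (simp add: ival_below_def)
    have D'_less: "j < i" if "m < Suc i" "D' m = Some j" for m j
      using below[of m j] that \<open>i < n\<close> by linarith
    let ?J = "{j. j < i \<and> x < snd (I j) \<and> snd (I j) \<le> ?a}"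
    \<comment> \<open>A free place in \<open>?J\<close> would beat the choice of \<open>D\<close>,
      which is either a root or a parent with endpoint at most \<open>x\<close>.\<close>
    have full: "k \<le> card {m. m < i \<and> D m = Some j}" if "j \<in> ?J" for j
    proof (rule ccontr)
      assume "\<not> ?thesis"
      with that have "free_place k I D i j"
        by (simp add: free_place_def ival_below_def)
      with best[OF \<open>i < n\<close>] that True show False
        by (cases "D i") (force simp: best_fit_def)+
    qed
    have "card (attached_beyond I D' (Suc i) x) =
        (\<Sum>j\<in>?J. card {m. m < Suc i \<and> D' m = Some j}) + card (attached_beyond I D' (Suc i) ?a)"
      by (rule card_attached_beyond_split)
        (use j' j'_le D'_less in auto)
    \<comment> \<open>The parent \<open>j'\<close> ends by \<open>?a\<close>, so interval
      \<open>i\<close> itself is not counted beyond \<open>?a\<close> and the induction hypothesis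
      for time \<open>i\<close> applies.\<close>
    also have "card (attached_beyond I D' (Suc i) ?a) = card (attached_beyond I D' i ?a)"
      using j' j'_le by (simp add: card_attached_beyond_Suc)
    also have "\<dots> \<le> card (attached_beyond I D i ?a)"
      by (rule IH)
    also have "(\<Sum>j\<in>?J. card {m. m < Suc i \<and> D' m = Some j})
        \<le> (\<Sum>j\<in>?J. card {m. m < i \<and> D m = Some j})"
    proof (rule sum_mono)
      fix j assume "j \<in> ?J"
      have "card {m. m < Suc i \<and> D' m = Some j} \<le> card {m. m < n \<and> D' m = Some j}"
        using \<open>i < n\<close> by (intro card_mono) auto
      with arity[of j] full[OF \<open>j \<in> ?J\<close>]
      show "card {m. m < Suc i \<and> D' m = Some j} \<le> card {m. m < i \<and> D m = Some j}"
        by linarith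
    qed
    also have "(\<Sum>j\<in>?J. card {m. m < i \<and> D m = Some j}) + card (attached_beyond I D i ?a) =
        card (attached_beyond I D i x)"
      by (rule card_attached_beyond_split[symmetric]) (use j' j'_le D_less in auto)
    also have "\<dots> \<le> card (attached_beyond I D (Suc i) x)"
      by (simp add: card_attached_beyond_Suc)
    finally show ?thesis
      by simp
  qed
qed

text \<open>For a threshold below all right endpoints, being attached beyond it just means not being
  a root.\<close>

lemma best_fit_fewest_roots:
  assumes best: "\<And>i. i < n \<Longrightarrow> best_fit k I D i"
    and below: "\<And>m j. m < n \<Longrightarrow> D' m = Some j \<Longrightarrow> j < m \<and> ival_below (I j) (I m)"
    and arity: "\<And>j. card {m. m < n \<and> D' m = Some j} \<le> k"
  shows "card {m. m < n \<and> D m = None} \<le> card {m. m < n \<and> D' m = None}"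
proof -
  \<comment> \<open>The inserted 0 keeps \<open>Min\<close> defined for \<open>n = 0\<close>;
    subtracting 1 makes the bound strict.\<close>
  define x where "x = Min (insert 0 ((\<lambda>j. snd (I j)) ` {..<n})) - 1"
  have x: "x < snd (I j)" if "j < n" for j
  proof -
    have "Min (insert 0 ((\<lambda>j. snd (I j)) ` {..<n})) \<le> snd (I j)"
      using that by (intro Min_le) auto
    then show ?thesis
      by (simp add: x_def)
  qed
  have roots: "card {m. m < n \<and> F m = None} = n - card (attached_beyond I F n x)"
    if "\<And>m j. m < n \<Longrightarrow> F m = Some j \<Longrightarrow> j < m" for F
  proof -
    have "attached_beyond I F n x = {m. m < n \<and> F m \<noteq> None}"
      using that x unfolding attached_beyond_def by (fastforce dest: less_trans)
    then have "{m. m < n \<and> F m = None} = {..<n} - attached_beyond I F n x"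
      by (simp only:) blast
    moreover have "attached_beyond I F n x \<subseteq> {..<n}"
      by (auto simp: attached_beyond_def)
    ultimately show ?thesis
      by (simp add: card_Diff_subset)
  qed
  have "j < m" if "m < n" "D m = Some j" for m j
    using best[OF that(1)] that(2) by (simp add: best_fit_def free_place_def)
  then have "card {m. m < n \<and> D m = None} = n - card (attached_beyond I D n x)"
    by (rule roots)
  moreover have "card {m. m < n \<and> D' m = None} = n - card (attached_beyond I D' n x)"
    by (rule roots) (use below in blast)
  moreover have "card (attached_beyond I D' n x) \<le> card (attached_beyond I D n x)"
    by (rule best_fit_dominates[OF best below arity order.refl])
  ultimately show ?thesis
    by (simp only: diff_le_mono2)
qed

section \<open>Forests and partitions into chains\<close>

lemma finite_seq_elems [simp]: "finite (seq_elems S)"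
  by (simp add: seq_elems_def)

lemma seq_elems_iff: "(i, I) \<in> seq_elems S \<longleftrightarrow> i < length S \<and> I = S ! i"
  by (auto simp: seq_elems_def)

text \<open>Passing from the left to the right endpoint of the middle interval is where properness
  enters.\<close>

lemma seq_less_trans:
  assumes "\<And>I. I \<in> set S \<Longrightarrow> proper_ival I" "y \<in> seq_elems S" "seq_less x y" "seq_less y z"
  shows "seq_less x z"
proof -
  have "proper_ival (snd y)"
    using assms(1)[of "snd y"] assms(2) by (auto simp: seq_elems_def)
  then show ?thesis
    using assms(3,4) by (simp add: seq_less_def ival_below_def proper_ival_def)
qed

section \<open>Legal insertions give a partition into k-ary chains\<close>

context
  fixes k :: nat and S :: "ival list" and D :: "nat option list"
  assumes proper: "\<And>I. I \<in> set S \<Longrightarrow> proper_ival I"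
    and legal: "legal_insertions k S D"
begin

lemma forest_edgesD:
  assumes "(x, y) \<in> forest_edges S D"
  shows "x \<in> seq_elems S" "y \<in> seq_elems S" "seq_less x y" "D ! fst y = Some (fst x)"
  using assms legal unfolding forest_edges_def legal_insertions_def
  by (fastforce simp: seq_elems_iff seq_less_def)+

lemma forest_edges_single_valued:
  assumes "(x, z) \<in> forest_edges S D" "(y, z) \<in> forest_edges S D"
  shows "x = y"
  using assms by (auto simp: forest_edges_def)

lemma forest_trancl_less: "(x, y) \<in> (forest_edges S D)\<^sup>+ \<Longrightarrow> seq_less x y"
proof (induction rule: trancl_induct)
  case (base y)
  then show ?case
    by (rule forest_edgesD)
next
  case (step y z)
  then show ?case
    using seq_less_trans[OF proper] forest_edgesD by blast
qed

text \<open>Parents have smaller positions, so following them backwards ends at a root.\<close>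

lemma reached_from_root:
  "i < length S \<Longrightarrow> \<exists>r < length S. D ! r = None \<and> ((r, S ! r), (i, S ! i)) \<in> (forest_edges S D)\<^sup>*"
proof (induction i rule: less_induct)
  case (less i)
  show ?case
  proof (cases "D ! i")
    case None
    with less.prems show ?thesis
      by blast
  next
    case (Some j)
    with legal less.prems have "j < i"
      by (simp add: legal_insertions_def)
    then obtain r where "r < length S" "D ! r = None"
      "((r, S ! r), (j, S ! j)) \<in> (forest_edges S D)\<^sup>*"
      using less.IH[of j] less.prems by auto
    moreover have "((j, S ! j), (i, S ! i)) \<in> forest_edges S D"
      using Some less.prems by (auto simp: forest_edges_def)
    ultimately show ?thesis
      by (blast intro: rtrancl_into_rtrancl)
  qed
qed

lemma no_edge_to_root: "D ! r = None \<Longrightarrow> (x, (r, S ! r)) \<notin> forest_edges S D"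
  by (auto simp: forest_edges_def)

text \<open>Parents are unique, so two paths into \<open>x\<close> share their last edge. Peeling
  off edges ends at a root, which no edge enters, so both paths are exhausted together.\<close>

lemma root_unique:
  assumes "((r, S ! r), x) \<in> (forest_edges S D)\<^sup>*" "((q, S ! q), x) \<in> (forest_edges S D)\<^sup>*"
    and "D ! r = None" "D ! q = None"
  shows "r = q"
  using assms(1,2)
proof (induction rule: rtrancl_induct)
  case base
  then show ?case
    by (rule rtranclE) (use no_edge_to_root[OF assms(3)] in auto)
next
  case (step y z)
  from step.prems show ?case
  proof (cases rule: rtranclE)
    case base
    then show ?thesis
      using step.hyps(2) no_edge_to_root[OF assms(4)] by simp
  next
    case (step w)
    then show ?thesis
      using \<open>(y, z) \<in> _\<close> forest_edges_single_valued \<open>_ \<Longrightarrow> r = q\<close> by blast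
  qed
qed

text \<open>Legality bounds the number of children only just before an insertion. Applied to the
  last child, it leaves fewer than \<open>k\<close> earlier ones, plus that child.\<close>

lemma card_children_le: "card {m. m < length S \<and> D ! m = Some j} \<le> k"
proof (cases "{m. m < length S \<and> D ! m = Some j} = {}")
  case False
  let ?C = "{m. m < length S \<and> D ! m = Some j}"
  have "finite ?C"
    by simp
  define i where "i = Max ?C"
  have i: "i \<in> ?C"
    unfolding i_def using \<open>finite ?C\<close> False by (rule Max_in)
  have "m \<le> i" if "m \<in> ?C" for m
    unfolding i_def using \<open>finite ?C\<close> that by (rule Max_ge)
  then have "?C \<subseteq> insert i {m. m < i \<and> D ! m = Some j}"
    by (fastforce simp: less_le)
  then have "card ?C \<le> card (insert i {m. m < i \<and> D ! m = Some j})"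
    by (intro card_mono) auto
  also have "\<dots> \<le> Suc (card {m. m < i \<and> D ! m = Some j})"
    by (simp add: card_insert_le_m1)
  also have "\<dots> \<le> k"
    using legal i by (auto simp: legal_insertions_def Suc_le_eq)
  finally show ?thesis .
qed (simp only: card.empty le0)

text \<open>The witnessing tree is the forest restricted to the class, with the identity as
  bijection.\<close>

lemma kary_chain_class:
  assumes "r < length S" "D ! r = None"
  shows "kary_chain k (seq_elems S) seq_less ((forest_edges S D)\<^sup>* `` {(r, S ! r)})"
proof -
  let ?E = "forest_edges S D"
  let ?r = "(r, S ! r)"
  let ?A = "?E\<^sup>* `` {?r}"
  let ?F = "?E \<inter> ?A \<times> ?A"
  have A: "?A \<subseteq> seq_elems S"
  proof
    fix x assume "x \<in> ?A"
    then have "(?r, x) \<in> ?E\<^sup>*"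
      by simp
    then show "x \<in> seq_elems S"
      by (cases rule: rtranclE) (use assms forest_edgesD in \<open>auto simp: seq_elems_iff\<close>)
  qed
  \<comment> \<open>A path from the root never leaves \<open>?A\<close>, since each of its vertices
    is reachable too.\<close>
  have reach: "(?r, x) \<in> ?F\<^sup>*" if "(?r, x) \<in> ?E\<^sup>*" for x
    using that
  proof (induction rule: rtrancl_induct)
    case (step y z)
    then have "(y, z) \<in> ?F"
      by auto
    with step.IH show ?case
      by (rule rtrancl_into_rtrancl)
  qed simp
  have parent: "\<exists>!u. (u, v) \<in> ?F" if "v \<in> ?A - {?r}" for v
  proof -
    from that have "(?r, v) \<in> ?E\<^sup>*" "v \<noteq> ?r"
      by auto
    then obtain u where "(?r, u) \<in> ?E\<^sup>*" "(u, v) \<in> ?E"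
      by (auto elim: rtranclE)
    then show ?thesis
      using that forest_edges_single_valued by blast
  qed
  have tree: "rooted_tree ?A ?F ?r"
    unfolding rooted_tree_def using reach parent no_edge_to_root[OF assms(2)] by auto
  have arity: "finite (?F `` {u}) \<and> card (?F `` {u}) \<le> k" for u
  proof -
    let ?C = "{m. m < length S \<and> D ! m = Some (fst u)}"
    have "?F `` {u} \<subseteq> (\<lambda>m. (m, S ! m)) ` ?C"
      by (auto simp: forest_edges_def)
    moreover have "card ((\<lambda>m. (m, S ! m)) ` ?C) \<le> card ?C"
      by (rule card_image_le) simp
    ultimately show ?thesis
      using card_children_le[of "fst u"] finite_subset[of "?F `` {u}"]
        card_mono[of "(\<lambda>m. (m, S ! m)) ` ?C" "?F `` {u}"] by simp
  qed
  have "seq_less u v" if "(u, v) \<in> ?F\<^sup>+" for u v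
    using that trancl_mono[of "(u, v)" ?F ?E] forest_trancl_less by blast
  with tree arity have "\<exists>(V :: (nat \<times> ival) set) E r \<phi>. kary_rooted_tree k V E r \<and>
      bij_betw \<phi> V ?A \<and> (\<forall>u v. (u, v) \<in> E\<^sup>+ \<longrightarrow> seq_less (\<phi> u) (\<phi> v))"
    by (intro exI[of _ ?A] exI[of _ ?F] exI[of _ ?r] exI[of _ "\<lambda>x. x"])
      (auto simp: kary_rooted_tree_def bij_betw_def)
  with A show ?thesis
    unfolding kary_chain_def by blast
qed

lemma kary_partition_forest_classes:
  "kary_partition k (seq_elems S) seq_less (forest_classes S D)"
proof -
  have chain: "kary_chain k (seq_elems S) seq_less A" if "A \<in> forest_classes S D" for A
    using that kary_chain_class by (auto simp: forest_classes_def)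
  have "\<Union> (forest_classes S D) = seq_elems S"
  proof
    show "\<Union> (forest_classes S D) \<subseteq> seq_elems S"
      using chain unfolding kary_chain_def by blast
    show "seq_elems S \<subseteq> \<Union> (forest_classes S D)"
    proof
      fix x assume "x \<in> seq_elems S"
      then obtain i where "i < length S" "x = (i, S ! i)"
        by (auto simp: seq_elems_def)
      moreover from this obtain r where "r < length S" "D ! r = None"
        "((r, S ! r), (i, S ! i)) \<in> (forest_edges S D)\<^sup>*"
        using reached_from_root by blast
      ultimately show "x \<in> \<Union> (forest_classes S D)"
        unfolding forest_classes_def by blast
    qed
  qed
  moreover have "disjoint (forest_classes S D)"
    unfolding disjoint_def forest_classes_def using root_unique by blast
  moreover have "{} \<notin> forest_classes S D"
    by (auto simp: forest_classes_def)
  ultimately show ?thesis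
    using chain by (simp add: kary_partition_def partition_on_def)
qed

end

section \<open>From arbitrary partitions back to parent functions\<close>

lemma card_forest_classes_le:
  "card (forest_classes S D) \<le> card {i. i < length S \<and> D ! i = None}"
proof -
  have "forest_classes S D =
      (\<lambda>i. (forest_edges S D)\<^sup>* `` {(i, S ! i)}) ` {i. i < length S \<and> D ! i = None}"
    by (auto simp: forest_classes_def)
  then show ?thesis
    by (simp add: card_image_le)
qed

text \<open>Transports the tree along the bijection and keeps only its root and parent function.
  Finiteness is stated along with the bound because \<open>card\<close> of an infinite set is
  0.\<close>

lemma kary_chain_parent:
  assumes "kary_chain k X lt A"
  shows "\<exists>q par. q \<in> A \<and> (\<forall>v \<in> A - {q}. par v \<in> A \<and> lt (par v) v) \<and>
    (\<forall>u. finite {v \<in> A - {q}. par v = u} \<and> card {v \<in> A - {q}. par v = u} \<le> k)"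
proof -
  from assms obtain V :: "'a set" and E r \<phi> where tree: "kary_rooted_tree k V E r"
    and bij: "bij_betw \<phi> V A" and lt: "\<And>u v. (u, v) \<in> E\<^sup>+ \<Longrightarrow> lt (\<phi> u) (\<phi> v)"
    by (auto simp: kary_chain_def)
  let ?\<psi> = "inv_into V \<phi>"
  \<comment> \<open>The description is meaningful only away from the root, where the tree has
    exactly one parent.\<close>
  define par where "par v = \<phi> (THE u. (u, ?\<psi> v) \<in> E)" for v
  have r: "r \<in> V" and E: "E \<subseteq> V \<times> V" and unique: "\<And>v. v \<in> V - {r} \<Longrightarrow> \<exists>!u. (u, v) \<in> E"
    and arity: "\<And>u. u \<in> V \<Longrightarrow> finite (E `` {u}) \<and> card (E `` {u}) \<le> k"
    using tree by (auto simp: kary_rooted_tree_def rooted_tree_def)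
  have \<psi>: "?\<psi> v \<in> V - {r}" "\<phi> (?\<psi> v) = v" if "v \<in> A - {\<phi> r}" for v
    using that bij by (auto simp: bij_betw_def inv_into_into f_inv_into_f)
  have par: "\<exists>u\<in>V. (u, ?\<psi> v) \<in> E \<and> par v = \<phi> u" if "v \<in> A - {\<phi> r}" for v
    using theI'[OF unique[OF \<psi>(1)[OF that]]] E by (auto simp: par_def)
  have root: "\<phi> r \<in> A"
    using r bij by (auto simp: bij_betw_def)
  have below: "par v \<in> A \<and> lt (par v) v" if v: "v \<in> A - {\<phi> r}" for v
  proof -
    from par[OF v] obtain u where "u \<in> V" "(u, ?\<psi> v) \<in> E" "par v = \<phi> u"
      by blast
    then show ?thesis
      using lt[of u "?\<psi> v"] \<psi>(2)[OF v] bij by (auto simp: bij_betw_def)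
  qed
  have children: "finite {v \<in> A - {\<phi> r}. par v = u} \<and> card {v \<in> A - {\<phi> r}. par v = u} \<le> k"
    (is "finite ?C \<and> card ?C \<le> k") for u
  proof (cases "u \<in> A")
    case True
    have "?C \<subseteq> \<phi> ` (E `` {?\<psi> u})"
    proof
      fix v assume "v \<in> ?C"
      then have v: "v \<in> A - {\<phi> r}" "par v = u"
        by auto
      with par obtain w where "w \<in> V" "(w, ?\<psi> v) \<in> E" "u = \<phi> w"
        by blast
      moreover from this have "?\<psi> u = w"
        using bij by (simp add: bij_betw_def)
      ultimately show "v \<in> \<phi> ` (E `` {?\<psi> u})"
        using \<psi>(2)[OF v(1)] by (metis ImageI image_eqI singletonI)
    qed
    moreover have "finite (E `` {?\<psi> u})" "card (E `` {?\<psi> u}) \<le> k"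
      using arity[of "?\<psi> u"] True bij by (auto simp: bij_betw_def inv_into_into)
    ultimately show ?thesis
      by (meson card_image_le card_mono finite_imageI finite_subset le_trans)
  next
    case False
    then have "?C = {}"
      using par bij by (auto simp: bij_betw_def)
    then show ?thesis
      by (metis card.empty finite.emptyI le0)
  qed
  show ?thesis
    by (intro exI[of _ "\<phi> r"] exI[of _ par]) (use root below children in blast)
qed

text \<open>Glues the parent functions of all classes into one on positions, which is the competitor
  for best fit. Each class contributes a single root, so roots inject into \<open>Q\<close>.\<close>

lemma kary_partition_parent:
  assumes "kary_partition k (seq_elems S) seq_less Q"
  obtains D where "\<And>m j. m < length S \<Longrightarrow> D m = Some j \<Longrightarrow> j < m \<and> ival_below (S ! j) (S ! m)"
    "\<And>j. card {m. m < length S \<and> D m = Some j} \<le> k"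
    "card {m. m < length S \<and> D m = None} \<le> card Q"
proof -
  have part: "partition_on (seq_elems S) Q"
    and chain: "\<And>A. A \<in> Q \<Longrightarrow> kary_chain k (seq_elems S) seq_less A"
    using assms by (auto simp: kary_partition_def)
  define tree where "tree A q par \<longleftrightarrow> q \<in> A \<and> (\<forall>v \<in> A - {q}. par v \<in> A \<and> seq_less (par v) v) \<and>
      (\<forall>u. finite {v \<in> A - {q}. par v = u} \<and> card {v \<in> A - {q}. par v = u} \<le> k)" for A q par
  have "\<exists>q par. tree A q par" if "A \<in> Q" for A
    unfolding tree_def by (rule kary_chain_parent[OF chain[OF that]])
  then obtain q par where tree: "\<And>A. A \<in> Q \<Longrightarrow> tree A (q A) (par A)"
    by metis
  have par: "par A v \<in> A" "seq_less (par A v) v" if "A \<in> Q" "v \<in> A - {q A}" for A v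
    using tree[OF that(1)] that(2) unfolding tree_def by blast+
  have arity: "finite {v \<in> A - {q A}. par A v = u}" "card {v \<in> A - {q A}. par A v = u} \<le> k"
    if "A \<in> Q" for A u
    using tree[OF that] unfolding tree_def by blast+
  define cls where "cls x = (THE A. A \<in> Q \<and> x \<in> A)" for x
  have cls_eq: "cls x = A" if "A \<in> Q" "x \<in> A" for x A
    unfolding cls_def
    using that part by (intro the_equality) (auto simp: partition_on_def disjoint_def)
  have cls: "cls x \<in> Q" "x \<in> cls x" if "x \<in> seq_elems S" for x
  proof -
    from that part obtain A where "A \<in> Q" "x \<in> A"
      by (auto simp: partition_on_def)
    with cls_eq[of A x] show "cls x \<in> Q" "x \<in> cls x"
      by simp_all
  qed
  have sub: "x \<in> seq_elems S" if "x \<in> A" "A \<in> Q" for x A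
    using that part by (auto simp: partition_on_def)
  define el where "el m = (m, S ! m)" for m
  have el: "el m \<in> seq_elems S" if "m < length S" for m
    using that by (simp add: el_def seq_elems_iff)
  have el_fst: "el (fst x) = x" if "x \<in> seq_elems S" for x
    using that by (auto simp: el_def seq_elems_def)
  have inj_el: "inj_on el M" for M
    by (auto simp: inj_on_def el_def)
  define D where "D m = (let A = cls (el m) in
    if el m = q A then None else Some (fst (par A (el m))))" for m
  have SomeD: "par (cls (el m)) (el m) = el j \<and> el j \<in> cls (el m) \<and> seq_less (el j) (el m)
      \<and> el m \<in> cls (el m) - {q (cls (el m))}"
    if "m < length S" "D m = Some j" for m j
  proof -
    let ?A = "cls (el m)"
    have "el m \<in> ?A - {q ?A}" "j = fst (par ?A (el m))"
      using that cls el by (auto simp: D_def Let_def split: if_splits)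
    moreover have "?A \<in> Q"
      using cls el that(1) by blast
    ultimately show ?thesis
      using par[of ?A "el m"] el_fst[OF sub[of "par ?A (el m)" ?A]] by simp
  qed
  show thesis
  proof
    show "j < m \<and> ival_below (S ! j) (S ! m)" if "m < length S" "D m = Some j" for m j
      using SomeD[OF that] by (simp add: seq_less_def el_def)
    show "card {m. m < length S \<and> D m = Some j} \<le> k" (is "card ?C \<le> k") for j
    proof (cases "?C = {}")
      case False
      then obtain m where m: "m \<in> ?C"
        by blast
      \<comment> \<open>Children lie in the class of their parent, so all children of
        \<open>j\<close> are governed by the arity of this one tree.\<close>
      let ?A = "cls (el j)"
      have A: "?A \<in> Q"
        using SomeD[of m j] m cls(1)[OF el, of m] cls_eq[of "cls (el m)" "el j"] by simp
      have "el ` ?C \<subseteq> {v \<in> ?A - {q ?A}. par ?A v = el j}"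
      proof
        fix x assume "x \<in> el ` ?C"
        then obtain l where l: "l < length S" "D l = Some j" "x = el l"
          by auto
        have "cls (el l) = ?A"
          using SomeD[OF l(1,2)] cls_eq[OF cls(1)[OF el[OF l(1)]], of "el j"] by simp
        then show "x \<in> {v \<in> ?A - {q ?A}. par ?A v = el j}"
          using SomeD[OF l(1,2)] l(3) by simp
      qed
      then have "card (el ` ?C) \<le> k"
        using arity[OF A, of "el j"] by (meson card_mono le_trans)
      then show ?thesis
        by (simp add: card_image[OF inj_el])
    qed (simp only: card.empty le0)
    \<comment> \<open>Used by the closing \<open>fact\<close>: for infinite \<open>Q\<close>,
      \<open>card Q\<close> would be 0 and bound nothing.\<close>
    have "finite Q"
      using part finite_elements[OF finite_seq_elems] by blast
    have root: "el m = q (cls (el m))" if "D m = None" for m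
      using that by (auto simp: D_def Let_def split: if_splits)
    show "card {m. m < length S \<and> D m = None} \<le> card Q"
    proof (rule card_inj_on_le)
      show "inj_on (\<lambda>m. cls (el m)) {m. m < length S \<and> D m = None}"
        using root inj_el[of UNIV] by (auto simp: inj_on_def) metis
      show "(\<lambda>m. cls (el m)) ` {m. m < length S \<and> D m = None} \<subseteq> Q"
        using cls(1)[OF el] by auto
    qed fact
  qed
qed

text \<open>There are at most as many classes as best-fit roots, these are at most the roots of the
  parent function extracted from \<open>Q\<close>, and those are at most
  \<open>card Q\<close>.\<close>

lemma best_fit_optimal:
  assumes proper: "\<And>I. I \<in> set S \<Longrightarrow> proper_ival I" and "length D = length S"
    and best: "\<And>i. i < length S \<Longrightarrow> best_fit k ((!) S) ((!) D) i"
  shows "legal_insertions k S D"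
    and "minimum_kary_partition k (seq_elems S) seq_less (forest_classes S D)"
proof -
  have "free_place k ((!) S) ((!) D) i j" if "i < length S" "D ! i = Some j" for i j
    using best[OF that(1)] that(2) by (simp add: best_fit_def)
  then show legal: "legal_insertions k S D"
    using assms(2) by (auto simp: legal_insertions_def free_place_def)
  have "card (forest_classes S D) \<le> card Q"
    if Q: "kary_partition k (seq_elems S) seq_less Q" for Q
  proof -
    from kary_partition_parent[OF Q] obtain D'
      where "\<And>m j. m < length S \<Longrightarrow> D' m = Some j \<Longrightarrow> j < m \<and> ival_below (S ! j) (S ! m)"
        "\<And>j. card {m. m < length S \<and> D' m = Some j} \<le> k"
        "card {m. m < length S \<and> D' m = None} \<le> card Q"
      by blast
    with best_fit_fewest_roots[OF best, of "length S" D'] show ?thesis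
      using card_forest_classes_le[of S D] by fastforce
  qed
  with kary_partition_forest_classes[OF proper legal]
  show "minimum_kary_partition k (seq_elems S) seq_less (forest_classes S D)"
    by (simp add: minimum_kary_partition_def)
qed

section \<open>The program\<close>

text \<open>A total correctness rule with cost: \<open>f\<close> bounds the number of rounds, each
  costing \<open>c\<close> plus one test, and the final 1 is the failing test.\<close>

lemma exec_While_bounded:
  assumes step: "\<And>s. Inv s \<Longrightarrow> tval b s \<Longrightarrow> \<exists>t s'. exec P s t s' \<and> t \<le> c \<and> Inv s' \<and> f s' < f s"
    and "Inv s"
  shows "\<exists>t s'. exec (While b P) s t s' \<and> t \<le> Suc c * f s + 1 \<and> Inv s' \<and> \<not> tval b s'"
  using \<open>Inv s\<close>
proof (induction "f s" arbitrary: s rule: less_induct)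
  case less
  show ?case
  proof (cases "tval b s")
    case False
    then show ?thesis
      using less.prems exec.WhileFalse by force
  next
    case True
    from step[OF less.prems True] obtain t s' where 1: "exec P s t s'" "t \<le> c" "Inv s'" "f s' < f s"
      by blast
    from less.hyps[OF 1(4,3)] obtain u s'' where 2: "exec (While b P) s' u s''"
      "u \<le> Suc c * f s' + 1" "Inv s''" "\<not> tval b s''"
      by blast
    have "Suc c * Suc (f s') \<le> Suc c * f s"
      using 1(4) by (intro mult_le_mono2) simp
    then have "Suc (t + u) \<le> Suc c * f s + 1"
      using 1(2) 2(2) by simp
    with exec.WhileTrue[OF True 1(1) 2(1)] 2(3,4) show ?thesis
      by blast
  qed
qed

text \<open>
  Registers: \<open>nats 1 0\<close> is the number \<open>n\<close> of intervals placed before, \<open>nats 2 j\<close> the number of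
  children of node \<open>j\<close>, \<open>nats 3 0\<close> the loop counter, and \<open>reals 1 j\<close> the right endpoint of node \<open>j\<close>.
  The output cell \<open>nats 0 0\<close> holds the best node found so far, shifted by one.
\<close>

abbreviation "Out \<equiv> NCell 0 (Const 0)"
abbreviation "Num \<equiv> NCell 1 (Const 0)"
abbreviation "Ctr \<equiv> NCell 3 (Const 0)"

text \<open>The machine compares reals only strictly, so \<le> is a negated \<open>RLess\<close>;
  ties go to the later node. The guard on \<open>Out\<close> covers the case of no node found yet,
  where truncated subtraction would point to node 0.\<close>

definition better :: "nat \<Rightarrow> test" where
  "better k = Conj (NLess (NCell 2 Ctr) (Const k))
     (Conj (Neg (RLess (RCell 0 (Const 0)) (RCell 1 Ctr)))
       (Neg (Conj (NLess (Const 0) Out)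
         (RLess (RCell 1 Ctr) (RCell 1 (Minus Out (Const 1)))))))"

definition search_body :: "nat \<Rightarrow> prog" where
  "search_body k = Seq (Cond (better k) (NStore 0 (Const 0) (Plus Ctr (Const 1))) Skip)
     (NStore 3 (Const 0) (Plus Ctr (Const 1)))"

text \<open>Memory survives between runs, hence the resets at the start. The new interval is
  recorded only after the search, which therefore sees earlier nodes alone.\<close>

definition best_fit_prog :: "nat \<Rightarrow> prog" where
  "best_fit_prog k = Seq (NStore 0 (Const 0) (Const 0)) (Seq (NStore 3 (Const 0) (Const 0))
     (Seq (While (NLess Ctr Num) (search_body k))
     (Seq (Cond (NLess (Const 0) Out)
        (NStore 2 (Minus Out (Const 1)) (Plus (NCell 2 (Minus Out (Const 1))) (Const 1))) Skip)
     (Seq (RStore 1 Num (RCell 0 (Const 1))) (NStore 1 (Const 0) (Plus Num (Const 1)))))))"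

definition candidate :: "nat \<Rightarrow> memory \<Rightarrow> nat \<Rightarrow> bool" where
  "candidate k s j \<longleftrightarrow> nats s 2 j < k \<and> reals s 1 j \<le> reals s 0 0"

text \<open>The register version of \<open>best_fit\<close>, restricted to the first
  \<open>n\<close> nodes so that it can serve as loop invariant with the counter for
  \<open>n\<close>.\<close>

definition best_among :: "nat \<Rightarrow> memory \<Rightarrow> nat \<Rightarrow> nat option \<Rightarrow> bool" where
  "best_among k s n d \<longleftrightarrow> (case d of
       None \<Rightarrow> \<forall>j<n. \<not> candidate k s j
     | Some j \<Rightarrow> j < n \<and> candidate k s j \<and>
         (\<forall>j'<n. candidate k s j' \<longrightarrow> reals s 1 j' \<le> reals s 1 j))"

text \<open>Candidates are judged in the memory \<open>s0\<close> at loop entry; the preserved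
  registers make this agree with the current memory.\<close>

definition search_inv :: "nat \<Rightarrow> memory \<Rightarrow> memory \<Rightarrow> bool" where
  "search_inv k s0 s \<longleftrightarrow> reals s = reals s0 \<and> nats s 1 = nats s0 1 \<and> nats s 2 = nats s0 2 \<and>
     nats s 3 0 \<le> nats s0 1 0 \<and> best_among k s0 (nats s 3 0) (decision s)"

lemma search_body_step:
  assumes inv: "search_inv k s0 s" and less: "nats s 3 0 < nats s 1 0"
  shows "\<exists>t s'. exec (search_body k) s t s' \<and> t \<le> 3 \<and> search_inv k s0 s' \<and>
    nats s0 1 0 - nats s' 3 0 < nats s0 1 0 - nats s 3 0"
proof (cases "tval (better k) s")
  case True
  let ?s1 = "s\<lparr>nats := (nats s)(0 := (nats s 0)(0 := nats s 3 0 + 1))\<rparr>"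
  let ?s2 = "?s1\<lparr>nats := (nats ?s1)(3 := (nats ?s1 3)(0 := nats ?s1 3 0 + 1))\<rparr>"
  have "exec (search_body k) s (Suc 1 + 1) ?s2"
    unfolding search_body_def
    using exec.NStore[of 0 "Const 0" "Plus Ctr (Const 1)" s]
      exec.NStore[of 3 "Const 0" "Plus Ctr (Const 1)" ?s1] True
    by (intro exec.Seq[where s' = ?s1] exec.CondTrue) simp_all
  moreover have "search_inv k s0 ?s2"
    using inv less True
    by (auto simp: search_inv_def better_def best_among_def candidate_def decision_def less_Suc_eq
        split: nat.splits)
  moreover have "nats s0 1 0 - nats ?s2 3 0 < nats s0 1 0 - nats s 3 0"
    using inv less by (simp add: search_inv_def diff_less_mono2)
  ultimately show ?thesis
    by (intro exI[of _ "Suc 1 + 1"] exI[of _ ?s2]) simp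
next
  case False
  let ?s2 = "s\<lparr>nats := (nats s)(3 := (nats s 3)(0 := nats s 3 0 + 1))\<rparr>"
  have "exec (search_body k) s (Suc 1 + 1) ?s2"
    unfolding search_body_def
    using exec.NStore[of 3 "Const 0" "Plus Ctr (Const 1)" s] False
    by (intro exec.Seq[where s' = s] exec.CondFalse exec.Skip) simp_all
  moreover have "search_inv k s0 ?s2"
    using inv less False
    by (auto simp: search_inv_def better_def best_among_def candidate_def decision_def less_Suc_eq
        split: nat.splits)
  moreover have "nats s0 1 0 - nats ?s2 3 0 < nats s0 1 0 - nats s 3 0"
    using inv less by (simp add: search_inv_def diff_less_mono2)
  ultimately show ?thesis
    by (intro exI[of _ "Suc 1 + 1"] exI[of _ ?s2]) simp
qed

text \<open>With \<open>n\<close> nodes present, the loop costs at most \<open>4 * n + 1\<close> (a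
  test and 3 steps per node, one last test); the commands around it cost 6.\<close>

lemma exec_best_fit_prog:
  "\<exists>t s'. exec (best_fit_prog k) s t s' \<and> t \<le> 4 * nats s 1 0 + 7 \<and>
     best_among k s (nats s 1 0) (decision s') \<and>
     nats s' 1 0 = Suc (nats s 1 0) \<and>
     (\<forall>j. nats s' 2 j = nats s 2 j + (if decision s' = Some j then 1 else 0)) \<and>
     reals s' 1 = (reals s 1)(nats s 1 0 := reals s 0 1)"
proof -
  let ?s1 = "s\<lparr>nats := (nats s)(0 := (nats s 0)(0 := 0))\<rparr>"
  let ?s2 = "?s1\<lparr>nats := (nats ?s1)(3 := (nats ?s1 3)(0 := 0))\<rparr>"
  have init: "exec (NStore 0 (Const 0) (Const 0)) s 1 ?s1" "exec (NStore 3 (Const 0) (Const 0)) ?s1 1 ?s2"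
    using exec.NStore[of 0 "Const 0" "Const 0" s] exec.NStore[of 3 "Const 0" "Const 0" ?s1] by simp_all
  have "search_inv k s ?s2"
    by (simp add: search_inv_def best_among_def decision_def)
  then obtain t s3 where loop: "exec (While (NLess Ctr Num) (search_body k)) ?s2 t s3"
    "t \<le> Suc 3 * (nats s 1 0 - nats ?s2 3 0) + 1" "search_inv k s s3" "\<not> nats s3 3 0 < nats s3 1 0"
    using exec_While_bounded[where Inv = "search_inv k s" and b = "NLess Ctr Num" and
        P = "search_body k" and c = 3 and f = "\<lambda>s'. nats s 1 0 - nats s' 3 0" and s = ?s2]
      search_body_step by (auto simp del: mult_Suc)
  have s3: "best_among k s (nats s 1 0) (decision s3)" "reals s3 = reals s"
    "nats s3 1 = nats s 1" "nats s3 2 = nats s 2"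
    using loop(3,4) by (auto simp: search_inv_def le_less)
  define s4 where "s4 = (if 0 < nats s3 0 0 then s3\<lparr>nats := (nats s3)(2 := (nats s3 2)
    (nats s3 0 0 - 1 := nats s3 2 (nats s3 0 0 - 1) + 1))\<rparr> else s3)"
  have count: "exec (Cond (NLess (Const 0) Out)
      (NStore 2 (Minus Out (Const 1)) (Plus (NCell 2 (Minus Out (Const 1))) (Const 1))) Skip) s3
      (Suc 1) s4"
  proof (cases "0 < nats s3 0 0")
    case True
    then show ?thesis
      using exec.NStore[of 2 "Minus Out (Const 1)" "Plus (NCell 2 (Minus Out (Const 1))) (Const 1)" s3]
      by (intro exec.CondTrue) (simp_all add: s4_def)
  next
    case False
    then show ?thesis
      using exec.Skip[of s3] by (intro exec.CondFalse) (simp_all add: s4_def)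
  qed
  let ?s5 = "s4\<lparr>reals := (reals s4)(1 := (reals s4 1)(nats s4 1 0 := reals s4 0 1))\<rparr>"
  let ?s6 = "?s5\<lparr>nats := (nats ?s5)(1 := (nats ?s5 1)(0 := nats ?s5 1 0 + 1))\<rparr>"
  have final: "exec (RStore 1 Num (RCell 0 (Const 1))) s4 1 ?s5"
    "exec (NStore 1 (Const 0) (Plus Num (Const 1))) ?s5 1 ?s6"
    using exec.RStore[of 1 Num "RCell 0 (Const 1)" s4] exec.NStore[of 1 "Const 0" "Plus Num (Const 1)" ?s5]
    by simp_all
  have "exec (best_fit_prog k) s (1 + (1 + (t + (Suc 1 + (1 + 1))))) ?s6"
    unfolding best_fit_prog_def by (intro exec.Seq) (fact init loop count final)+
  moreover have "decision ?s6 = decision s3"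
    by (simp add: decision_def s4_def)
  moreover have "nats s4 2 j = nats s 2 j + (if decision s3 = Some j then 1 else 0)" for j
    using s3 by (auto simp: s4_def decision_def split: nat.splits)
  moreover have "reals s4 = reals s" "nats s4 1 = nats s 1"
    using s3 by (simp_all add: s4_def)
  ultimately show ?thesis
    using s3(1) loop(2) by (intro exI[of _ "1 + (1 + (t + (Suc 1 + (1 + 1))))"] exI[of _ ?s6]) simp
qed

section \<open>The program simulates best fit along the whole input\<close>

text \<open>Child counts are required for all \<open>j\<close>, including nodes not yet placed, so a
  new node's counter needs no initialisation.\<close>

definition represents :: "memory \<Rightarrow> ival list \<Rightarrow> nat option list \<Rightarrow> bool" where
  "represents s S D \<longleftrightarrow> nats s 1 0 = length S \<and>
     (\<forall>j. nats s 2 j = card {m. m < length S \<and> D ! m = Some j}) \<and>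
     (\<forall>j < length S. reals s 1 j = snd (S ! j))"

text \<open>Best fit at \<open>i\<close> looks only at positions up to \<open>i\<close>, so
  appending further intervals and decisions leaves it intact.\<close>

lemma best_fit_cong:
  assumes "\<And>j. j \<le> i \<Longrightarrow> I j = I' j \<and> D j = D' j"
  shows "best_fit k I D i \<longleftrightarrow> best_fit k I' D' i"
proof -
  have "{m. m < i \<and> D m = Some j} = {m. m < i \<and> D' m = Some j}" for j
    using assms by force
  then have free: "free_place k I D i j \<longleftrightarrow> free_place k I' D' i j" for j
    using assms by (auto simp: free_place_def)
  moreover have "snd (I j) = snd (I' j)" if "free_place k I D i j" for j
    using that assms by (simp add: free_place_def)
  moreover have "D i = D' i"
    using assms by simp
  ultimately show ?thesis
    unfolding best_fit_def by (auto split: option.split)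
qed

lemma best_fit_prog_step:
  assumes len: "length D = length S" and rep: "represents s S D"
  shows "\<exists>t s'. exec (best_fit_prog k) (load_ival I s) t s' \<and> t \<le> 4 * length S + 7 \<and>
    represents s' (S @ [I]) (D @ [decision s']) \<and>
    best_fit k ((!) (S @ [I])) ((!) (D @ [decision s'])) (length S)"
proof -
  let ?s = "load_ival I s"
  let ?n = "length S"
  have s: "nats ?s 1 0 = ?n" "nats ?s 2 j = card {m. m < ?n \<and> D ! m = Some j}"
    "j < ?n \<Longrightarrow> reals ?s 1 j = snd (S ! j)" "reals ?s 0 0 = fst I" "reals ?s 0 1 = snd I" for j
    using rep by (simp_all add: load_ival_def represents_def)
  obtain t s' where run: "exec (best_fit_prog k) ?s t s'" "t \<le> 4 * ?n + 7"
    and best: "best_among k ?s ?n (decision s')"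
    and num: "nats s' 1 0 = Suc ?n"
    and cnt: "\<And>j. nats s' 2 j = nats ?s 2 j + (if decision s' = Some j then 1 else 0)"
    and ends: "reals s' 1 = (reals ?s 1)(?n := snd I)"
    using exec_best_fit_prog[of k ?s] by (auto simp only: s(1,5))
  let ?D = "D @ [decision s']"
  have old: "{m. m < ?n \<and> ?D ! m = Some j} = {m. m < ?n \<and> D ! m = Some j}" for j
    using len by (auto simp: nth_append)
  have "{m. m < Suc ?n \<and> ?D ! m = Some j} =
      (if decision s' = Some j then insert ?n else id) {m. m < ?n \<and> D ! m = Some j}" for j
    using len by (auto simp: nth_append less_Suc_eq)
  then have "nats s' 2 j = card {m. m < Suc ?n \<and> ?D ! m = Some j}" for j
    using cnt[of j] by (simp add: s(2))
  moreover have "reals s' 1 j = snd ((S @ [I]) ! j)" if "j < Suc ?n" for j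
    using that ends s(3)[of j] by (auto simp: nth_append less_Suc_eq)
  ultimately have rep': "represents s' (S @ [I]) ?D"
    using num by (simp add: represents_def)
  \<comment> \<open>The bridge from program to combinatorics: candidates in the registers are
    exactly the free places for the new interval.\<close>
  have free: "free_place k ((!) (S @ [I])) ((!) ?D) ?n j \<longleftrightarrow> j < ?n \<and> candidate k ?s j" for j
    unfolding free_place_def candidate_def old s(2,4)
    using s(3)[of j] by (auto simp: ival_below_def nth_append)
  have "best_fit k ((!) (S @ [I])) ((!) ?D) ?n"
  proof (cases "decision s'")
    case None
    with best have "\<forall>j. \<not> free_place k ((!) (S @ [I])) ((!) ?D) ?n j"
      unfolding free by (simp add: best_among_def)
    moreover have "?D ! ?n = None"
      using len None by (simp add: nth_append)
    ultimately show ?thesis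
      unfolding best_fit_def by simp
  next
    case (Some j)
    with best have "j < ?n" "candidate k ?s j"
      "\<And>j'. j' < ?n \<Longrightarrow> candidate k ?s j' \<Longrightarrow> snd (S ! j') \<le> snd (S ! j)"
      using s(3) by (auto simp: best_among_def)
    then have "free_place k ((!) (S @ [I])) ((!) ?D) ?n j"
      "\<forall>j'. free_place k ((!) (S @ [I])) ((!) ?D) ?n j' \<longrightarrow> snd ((S @ [I]) ! j') \<le> snd ((S @ [I]) ! j)"
      unfolding free by (simp_all add: nth_append)
    moreover have "?D ! ?n = Some j"
      using len Some by (simp add: nth_append)
    ultimately show ?thesis
      unfolding best_fit_def by simp
  qed
  with run rep' show ?thesis
    by blast
qed

text \<open>Generalised to a prefix \<open>S\<close> already placed, for induction on the remaining
  input \<open>S'\<close>. No run sees more than \<open>length S + length S'\<close> intervals,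
  which bounds the cost of each.\<close>

lemma online_run_best_fit:
  assumes "length D = length S" "represents s S D"
    "\<And>i. i < length S \<Longrightarrow> best_fit k ((!) S) ((!) D) i"
  shows "\<exists>D' t. online_run (best_fit_prog k) s S' D' t \<and> length D' = length S' \<and>
    t \<le> length S' * (4 * (length S + length S') + 7) \<and>
    (\<forall>i < length (S @ S'). best_fit k ((!) (S @ S')) ((!) (D @ D')) i)"
  using assms
proof (induction S' arbitrary: S D s)
  case Nil
  then show ?case
    using online_run.Nil by fastforce
next
  case (Cons I S')
  from best_fit_prog_step[OF Cons.prems(1,2), of k I] obtain t s'
    where run: "exec (best_fit_prog k) (load_ival I s) t s'" "t \<le> 4 * length S + 7"
      and rep: "represents s' (S @ [I]) (D @ [decision s'])"
      and best: "best_fit k ((!) (S @ [I])) ((!) (D @ [decision s'])) (length S)"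
    by blast
  have "best_fit k ((!) (S @ [I])) ((!) (D @ [decision s'])) i" if "i < length (S @ [I])" for i
  proof (cases "i = length S")
    case False
    with that have "i < length S"
      by simp
    then show ?thesis
      using Cons.prems(3)[of i] Cons.prems(1)
        best_fit_cong[of i "(!) S" "(!) (S @ [I])" "(!) D" "(!) (D @ [decision s'])"]
      by (simp add: nth_append)
  qed (use best in simp)
  with Cons.IH[OF _ rep] Cons.prems(1) obtain D' u
    where D': "online_run (best_fit_prog k) s' S' D' u" "length D' = length S'"
      "u \<le> length S' * (4 * (length (S @ [I]) + length S') + 7)"
      "\<forall>i < length ((S @ [I]) @ S'). best_fit k ((!) ((S @ [I]) @ S')) ((!) ((D @ [decision s']) @ D')) i"
    by force
  show ?case
  proof (intro exI conjI)
    show "online_run (best_fit_prog k) s (I # S') (decision s' # D') (t + u)"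
      using run(1) D'(1) by (rule online_run.Cons)
    \<comment> \<open>Moving \<open>I\<close> into the prefix keeps the sum of both lengths, hence
      the bound per run, unchanged.\<close>
    show "t + u \<le> length (I # S') * (4 * (length S + length (I # S')) + 7)"
      using run(2) D'(3) by (simp add: algebra_simps)
  qed (use D' in simp_all)
qed

theorem theorem2:
  fixes k :: nat
  assumes "k \<ge> 1"
  shows "\<exists>(P :: prog) (p :: nat poly). \<forall>S :: ival list. (\<forall>I\<in>set S. proper_ival I) \<longrightarrow>
    (\<exists>D t. online_run P start_memory S D t \<and>
       t \<le> poly p (length S) \<and>
       legal_insertions k S D \<and>
       minimum_kary_partition k (seq_elems S) seq_less (forest_classes S D))"
\<comment> \<open>The polynomial is \<open>n * (4 * n + 7)\<close>, with coefficients listed from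
  the constant term up.\<close>
proof (intro exI[of _ "best_fit_prog k"] exI[of _ "[:0, 7, 4:]"] allI impI)
  fix S :: "ival list"
  assume proper: "\<forall>I\<in>set S. proper_ival I"
  have "represents start_memory [] []"
    by (simp add: represents_def start_memory_def)
  from online_run_best_fit[OF _ this, of k S] obtain D t
    where "online_run (best_fit_prog k) start_memory S D t" "length D = length S"
      "t \<le> length S * (4 * length S + 7)" "\<And>i. i < length S \<Longrightarrow> best_fit k ((!) S) ((!) D) i"
    by auto
  with best_fit_optimal[of S D k] proper
  show "\<exists>D t. online_run (best_fit_prog k) start_memory S D t \<and> t \<le> poly [:0, 7, 4:] (length S) \<and>
      legal_insertions k S D \<and>
      minimum_kary_partition k (seq_elems S) seq_less (forest_classes S D)"
    by (intro exI[of _ D] exI[of _ t]) (simp add: algebra_simps)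
qed

end
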